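(* Let $A\in\mathbb{R}^{n\times n}$ be symmetric with eigenvalues $\alpha_1\ge\cdots\ge\alpha_n$, $g\in\mathbb{R}^n$ nonzero, $\Delta>0$, and consider the TRS of minimizing $f(x)=\frac12x^TAx+x^Tg$ subject to $\|x\|\le\Delta$, in the easy case. With $x_{opt},\lambda_{opt},A_{opt},\kappa,x_k,\lambda_k,k_{\max},\epsilon_k$ as in the context, suppose $\|x_{opt}\|=\|x_k\|=\Delta$ for some $k\in\{1,\ldots,k_{\max}\}$ and let $r_k=(A+\lambda_kI)x_k+g$. Then $$\|r_k\|\le\|A_{opt}\|\sqrt{1+\frac{\epsilon_k^2}{\Delta^2}}\;\epsilon_k\le 2\|A_{opt}\|\sqrt{\Delta^2+\epsilon_k^2}\Big(\frac{\sqrt\kappa-1}{\sqrt\kappa+1}\Big)^k.$$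
   Context: All norms are Euclidean. $x_{opt}$ is a global minimizer of the TRS and $\lambda_{opt}\ge0$ its Lagrange multiplier: $(A+\lambda_{opt}I)x_{opt}=-g$, $\lambda_{opt}(\Delta-\|x_{opt}\|)=0$, $A+\lambda_{opt}I\succeq0$. Easy case: $\lambda_{opt}>-\alpha_n$. $A_{opt}=A+\lambda_{opt}I$, $\kappa=(\alpha_1+\lambda_{opt})/(\alpha_n+\lambda_{opt})$. The Lanczos process on $A$ with starting vector $g$ gives $Q_k=[q_1,\ldots,q_k]$ with orthonormal columns spanning $\mathcal{K}_k(A,g)=\mathrm{span}\{g,\ldots,A^{k-1}g\}$, $q_1=g/\|g\|$, tridiagonal $T_k=Q_k^TAQ_k$, and $AQ_k=Q_kT_k+\beta_kq_{k+1}e_k^T$; $k_{\max}$ is the first step at which Lanczos breaks down. GLTR iterate: $x_k=Q_kh_k$ where $h_k$ minimizes $\frac12h^TT_kh+\|g\|h^Te_1$ over $\|h\|\le\Delta$, with multiplier $\lambda_k\ge0$: $(T_k+\lambda_kI)h_k=-\|g\|e_1$, $\lambda_k(\Delta-\|h_k\|)=0$, $T_k+\lambda_kI\succeq0$. $\epsilon_k=\|(I-Q_kQ_k^T)x_{opt}\|=\min_{x\in\mathcal{K}_k(A,g)}\|x-x_{opt}\|$. *)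

theory Defs
  imports "HOL-Analysis.Analysis"
begin

text \<open>Objective of the trust-region subproblem (TRS).\<close>
definition trs_f :: "real^'n^'n \<Rightarrow> real^'n \<Rightarrow> real^'n \<Rightarrow> real" where
  "trs_f A g x = (1/2) * (x \<bullet> (A *v x)) + x \<bullet> g"

text \<open>Eigenvalues of a (symmetric) matrix; alpha_1 is the largest, alpha_n the smallest.\<close>
definition eigvals :: "real^'n^'n \<Rightarrow> real set" where
  "eigvals A = {a. \<exists>v. v \<noteq> 0 \<and> A *v v = a *\<^sub>R v}"

definition alpha_max :: "real^'n^'n \<Rightarrow> real" where
  "alpha_max A = Max (eigvals A)"

definition alpha_min :: "real^'n^'n \<Rightarrow> real" where
  "alpha_min A = Min (eigvals A)"

text \<open>Krylov subspace K_k(A,g) = span{g, Ag, ..., A^(k-1) g}.\<close>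
definition krylov :: "real^'n^'n \<Rightarrow> real^'n \<Rightarrow> nat \<Rightarrow> (real^'n) set" where
  "krylov A g k = span {((\<lambda>v. A *v v) ^^ j) g | j. j < k}"

text \<open>k_max: the first step at which Lanczos breaks down, i.e. beta_k = 0,
  equivalently K_(k+1)(A,g) = K_k(A,g).\<close>
definition k_max :: "real^'n^'n \<Rightarrow> real^'n \<Rightarrow> nat" where
  "k_max A g = (LEAST k. 1 \<le> k \<and> krylov A g (Suc k) = krylov A g k)"

text \<open>Lanczos vectors q_1,...,q_k (indexed 1..k): orthonormal, q_1 = g/||g||, and
  span{q_1..q_j} = K_j(A,g) for every j \<le> k (this is what the Lanczos process produces).\<close>
definition lanczos_vectors :: "real^'n^'n \<Rightarrow> real^'n \<Rightarrow> nat \<Rightarrow> (nat \<Rightarrow> real^'n) \<Rightarrow> bool" where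
  "lanczos_vectors A g k q \<longleftrightarrow>
     (\<forall>i\<in>{1..k}. \<forall>j\<in>{1..k}. q i \<bullet> q j = (if i = j then 1 else 0)) \<and>
     q 1 = (1 / norm g) *\<^sub>R g \<and>
     (\<forall>j\<in>{1..k}. span (q ` {1..j}) = krylov A g j)"

text \<open>Entries of the tridiagonal matrix T_k = Q_k^T A Q_k.\<close>
definition lanczos_T :: "real^'n^'n \<Rightarrow> (nat \<Rightarrow> real^'n) \<Rightarrow> nat \<Rightarrow> nat \<Rightarrow> real" where
  "lanczos_T A q i j = q i \<bullet> (A *v q j)"

text \<open>Vectors in R^k are represented as h :: nat => real, using only the entries 1..k.\<close>
definition knorm :: "nat \<Rightarrow> (nat \<Rightarrow> real) \<Rightarrow> real" where
  "knorm k h = sqrt (\<Sum>i=1..k. (h i)^2)"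

text \<open>Reduced objective  1/2 h^T T_k h + ||g|| h^T e_1.\<close>
definition gltr_phi :: "real^'n^'n \<Rightarrow> real^'n \<Rightarrow> (nat \<Rightarrow> real^'n) \<Rightarrow> nat \<Rightarrow> (nat \<Rightarrow> real) \<Rightarrow> real" where
  "gltr_phi A g q k h =
     (1/2) * (\<Sum>i=1..k. \<Sum>j=1..k. h i * lanczos_T A q i j * h j) + norm g * h 1"

text \<open>h_k together with multiplier lambda_k: h_k minimizes the reduced problem over ||h|| \<le> Delta and
  (T_k + lambda_k I) h_k = -||g|| e_1, lambda_k (Delta - ||h_k||) = 0, T_k + lambda_k I psd.\<close>
definition gltr_sol :: "real^'n^'n \<Rightarrow> real^'n \<Rightarrow> real \<Rightarrow> (nat \<Rightarrow> real^'n) \<Rightarrow> nat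
                         \<Rightarrow> (nat \<Rightarrow> real) \<Rightarrow> real \<Rightarrow> bool" where
  "gltr_sol A g \<Delta> q k h lam \<longleftrightarrow>
     knorm k h \<le> \<Delta> \<and>
     (\<forall>h'. knorm k h' \<le> \<Delta> \<longrightarrow> gltr_phi A g q k h \<le> gltr_phi A g q k h') \<and>
     lam \<ge> 0 \<and>
     (\<forall>i\<in>{1..k}. (\<Sum>j=1..k. lanczos_T A q i j * h j) + lam * h i
                    = - norm g * (if i = 1 then 1 else 0)) \<and>
     lam * (\<Delta> - knorm k h) = 0 \<and>
     (\<forall>y. (\<Sum>i=1..k. \<Sum>j=1..k. y i * (lanczos_T A q i j + (if i = j then lam else 0)) * y j) \<ge> 0)"

text \<open>x_k = Q_k h_k.\<close>
definition lanczos_comb :: "(nat \<Rightarrow> real^'n) \<Rightarrow> nat \<Rightarrow> (nat \<Rightarrow> real) \<Rightarrow> real^'n" where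
  "lanczos_comb q k h = (\<Sum>i=1..k. h i *\<^sub>R q i)"

text \<open>epsilon_k = ||(I - Q_k Q_k^T) x_opt||.\<close>
definition eps_k :: "(nat \<Rightarrow> real^'n) \<Rightarrow> nat \<Rightarrow> real^'n \<Rightarrow> real" where
  "eps_k q k x = norm (x - (\<Sum>i=1..k. (q i \<bullet> x) *\<^sub>R q i))"

end

(*
  Residual bound. Galerkin orthogonality gives r_k \<bottom> x_k, and
  A_opt (x_k - x_opt) = r_k + (lam_opt - lam_k) x_k, so by Pythagoras and the Cauchy-Schwarz
  inequality for the semidefinite form of A_opt,
    ||r_k||^2 \<le> ||A_opt (x_k - x_opt)||^2 \<le> ||A_opt|| (x_k - x_opt)^T A_opt (x_k - x_opt).
  On the sphere ||x|| = Delta the last quadratic form is 2 (f x - f x_opt), and x_k minimizes f over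
  the Krylov ball, so x_k may be replaced by the point y of the Krylov sphere nearest to x_opt.
  With P the orthogonal projection onto K_k(A,g), ||y - x_opt||^2 = 2 Delta (Delta - ||P x_opt||),
  which is at most (1 + eps_k^2/Delta^2) eps_k^2.

  Convergence of eps_k. The affine map L = c I - d A_opt sends the spectrum of A_opt, which lies in
  [alpha_n + lam_opt, alpha_1 + lam_opt], into [-1, 1], with c = (kappa + 1)/(kappa - 1). The vector
  x_opt - T_k(L) x_opt / T_k(c) lies in K_k(A,g) because A_opt x_opt = -g, while
  ||T_k(L) x_opt|| \<le> Delta. Hence eps_k \<le> Delta / T_k(c) \<le> 2 Delta rho^k with
  rho = (sqrt kappa - 1)/(sqrt kappa + 1).
*)

theory Submission
  imports Defs
begin

lemma symmetric_matrix_inner_commute: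
  fixes M :: "real^'n^'n"
  assumes "transpose M = M"
  shows "(M *v x) \<bullet> y = x \<bullet> (M *v y)"
  by (metis assms dot_lmul_matrix vector_transpose_matrix)

lemma symmetric_matrix_shift:
  fixes A :: "real^'n^'n"
  assumes "transpose A = A"
  shows "transpose (A + c *\<^sub>R mat 1) = A + c *\<^sub>R mat 1"
  using assms by (simp add: transpose_def vec_eq_iff mat_def)

lemma scaleR_mat_1_mult_vector [simp]: "(c *\<^sub>R mat 1) *v x = c *\<^sub>R (x::real^'n)"
  by (metis matrix_scaleR_vector_ac matrix_vector_mul_lid)

lemma matrix_vector_mult_shift [simp]:
  "(A + c *\<^sub>R mat 1) *v x = A *v x + c *\<^sub>R (x::real^'n)"
  by (simp add: matrix_vector_mult_add_rdistrib)

lemma shifted_eigenvector: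
  fixes A :: "real^'n^'n"
  shows "A *v e = \<mu> *\<^sub>R e \<Longrightarrow> (A + lam *\<^sub>R mat 1) *v e = (\<mu> + lam) *\<^sub>R e"
  by (simp add: scaleR_add_left)

section \<open>Orthonormal families and orthogonal projection\<close>

definition orthonormal_on :: "'i set \<Rightarrow> ('i \<Rightarrow> 'a::real_inner) \<Rightarrow> bool" where
  "orthonormal_on I u \<longleftrightarrow> (\<forall>i\<in>I. \<forall>j\<in>I. u i \<bullet> u j = (if i = j then 1 else 0))"

lemma inner_orthonormal_sum:
  assumes "finite I" "orthonormal_on I u" "i \<in> I"
  shows "u i \<bullet> (\<Sum>j\<in>I. c j *\<^sub>R u j) = c i"
proof -
  have "u i \<bullet> (\<Sum>j\<in>I. c j *\<^sub>R u j) = (\<Sum>j\<in>I. if j = i then c j else 0)"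
    using assms(2,3) unfolding orthonormal_on_def by (auto simp: inner_sum_right intro!: sum.cong)
  then show ?thesis
    using assms(1,3) by simp
qed

lemma norm_orthonormal_sum_sq:
  assumes "finite I" "orthonormal_on I u"
  shows "(norm (\<Sum>j\<in>I. c j *\<^sub>R u j))\<^sup>2 = (\<Sum>j\<in>I. (c j)\<^sup>2)"
proof -
  have "(norm (\<Sum>j\<in>I. c j *\<^sub>R u j))\<^sup>2 = (\<Sum>j\<in>I. c j * (u j \<bullet> (\<Sum>j\<in>I. c j *\<^sub>R u j)))"
    by (simp add: power2_norm_eq_inner inner_sum_left)
  also have "\<dots> = (\<Sum>j\<in>I. (c j)\<^sup>2)"
    using inner_orthonormal_sum[OF assms] by (simp add: power2_eq_square)
  finally show ?thesis .
qed

definition orthonormal_proj :: "'i set \<Rightarrow> ('i \<Rightarrow> 'a::real_inner) \<Rightarrow> 'a \<Rightarrow> 'a" where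
  "orthonormal_proj I u x = (\<Sum>i\<in>I. (u i \<bullet> x) *\<^sub>R u i)"

lemma orthonormal_proj_in_span: "orthonormal_proj I u x \<in> span (u ` I)"
  unfolding orthonormal_proj_def by (intro span_sum span_scale span_base) auto

lemma inner_diff_orthonormal_proj:
  assumes "finite I" "orthonormal_on I u" "y \<in> span (u ` I)"
  shows "y \<bullet> (x - orthonormal_proj I u x) = 0"
proof -
  have "orthogonal (x - orthonormal_proj I u x) y"
  proof (rule orthogonal_to_span[OF assms(3)])
    fix v assume "v \<in> u ` I"
    then obtain i where "i \<in> I" "v = u i"
      by blast
    then show "orthogonal (x - orthonormal_proj I u x) v"
      using inner_orthonormal_sum[OF assms(1,2), of i "\<lambda>j. u j \<bullet> x"]
      by (simp add: orthogonal_def orthonormal_proj_def inner_diff_right inner_commute)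
  qed
  then show ?thesis
    by (simp add: orthogonal_def inner_commute)
qed

lemma orthonormal_proj_eq_self:
  assumes "finite I" "orthonormal_on I u" "x \<in> span (u ` I)"
  shows "orthonormal_proj I u x = x"
proof -
  have "x - orthonormal_proj I u x \<in> span (u ` I)"
    using assms(3) orthonormal_proj_in_span by (rule span_diff)
  then have "(x - orthonormal_proj I u x) \<bullet> (x - orthonormal_proj I u x) = 0"
    by (rule inner_diff_orthonormal_proj[OF assms(1,2)])
  then show ?thesis
    by simp
qed

lemma norm_diff_orthonormal_proj_le:
  assumes "finite I" "orthonormal_on I u" "v \<in> span (u ` I)"
  shows "norm (x - orthonormal_proj I u x) \<le> norm (x - v)"
proof -
  let ?p = "orthonormal_proj I u x"
  have "?p - v \<in> span (u ` I)"
    using orthonormal_proj_in_span assms(3) by (rule span_diff)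
  then have "(?p - v) \<bullet> (x - ?p) = 0"
    by (rule inner_diff_orthonormal_proj[OF assms(1,2)])
  then have "orthogonal (x - ?p) (?p - v)"
    by (simp add: orthogonal_def inner_commute)
  then have "(norm (x - v))\<^sup>2 = (norm (x - ?p))\<^sup>2 + (norm (?p - v))\<^sup>2"
    using norm_add_Pythagorean[of "x - ?p" "?p - v"] by simp
  then show ?thesis
    by (intro power2_le_imp_le[of "norm (x - ?p)"]) simp_all
qed

lemma norm_diff_orthonormal_proj_sq:
  assumes "finite I" "orthonormal_on I u"
  shows "(norm (x - orthonormal_proj I u x))\<^sup>2 = (norm x)\<^sup>2 - (norm (orthonormal_proj I u x))\<^sup>2"
proof -
  let ?p = "orthonormal_proj I u x"
  have "?p \<bullet> (x - ?p) = 0"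
    by (rule inner_diff_orthonormal_proj[OF assms orthonormal_proj_in_span])
  then have "(norm (?p + (x - ?p)))\<^sup>2 = (norm ?p)\<^sup>2 + (norm (x - ?p))\<^sup>2"
    by (intro norm_add_Pythagorean) (simp add: orthogonal_def)
  then show ?thesis
    by simp
qed

section \<open>Spectral theorem for symmetric matrices\<close>

lemma quadratic_nonneg_imp_discriminant_le:
  fixes p c q :: real
  assumes q: "q \<ge> 0" and nonneg: "\<And>t. 0 \<le> p + 2 * t * c + t\<^sup>2 * q"
  shows "c\<^sup>2 \<le> p * q"
proof (cases "q = 0")
  case True
  have "c = 0"
  proof (rule ccontr)
    assume "c \<noteq> 0"
    then have "p + 2 * (- (p + 1) / (2 * c)) * c = -1"
      by (simp add: field_simps)
    then show False
      using nonneg[of "- (p + 1) / (2 * c)"] True by simp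
  qed
  then show ?thesis
    using True by simp
next
  case False
  then have "q > 0"
    using q by simp
  have "p + 2 * (- c / q) * c + (- c / q)\<^sup>2 * q = p - c\<^sup>2 / q"
    using \<open>q > 0\<close> by (simp add: field_simps power2_eq_square)
  then have "c\<^sup>2 / q \<le> p"
    using nonneg[of "- c / q"] by simp
  then show ?thesis
    using \<open>q > 0\<close> by (simp add: pos_divide_le_eq mult.commute)
qed

lemma rayleigh_maximizer_exists:
  fixes M :: "real^'n^'n"
  assumes W: "subspace W" and nontriv: "W \<noteq> {0}"
  obtains v where "v \<in> W" "v \<bullet> v = 1" "\<And>u. u \<in> W \<Longrightarrow> u \<bullet> (M *v u) \<le> (v \<bullet> (M *v v)) * (u \<bullet> u)"
proof -
  define S where "S = W \<inter> sphere 0 1"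
  have "compact S"
    unfolding S_def using W by (intro closed_Int_compact closed_subspace compact_sphere)
  moreover obtain x where x: "x \<in> W" "x \<noteq> 0"
    using nontriv W subspace_0 by blast
  then have "x /\<^sub>R norm x \<in> S"
    unfolding S_def using W by (simp add: subspace_scale)
  then have "S \<noteq> {}" by blast
  moreover have "continuous_on S (\<lambda>x. x \<bullet> (M *v x))"
    by (intro continuous_on_inner continuous_on_id linear_continuous_on matrix_vector_mul_bounded_linear)
  ultimately obtain v where "v \<in> S" and vmax: "\<And>y. y \<in> S \<Longrightarrow> y \<bullet> (M *v y) \<le> v \<bullet> (M *v v)"
    by (metis continuous_attains_sup)
  have "u \<bullet> (M *v u) \<le> (v \<bullet> (M *v v)) * (u \<bullet> u)" if "u \<in> W" for u
  proof (cases "u = 0")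
    case False
    then have "u /\<^sub>R norm u \<in> S"
      unfolding S_def using that W by (simp add: subspace_scale)
    then have "(u /\<^sub>R norm u) \<bullet> (M *v (u /\<^sub>R norm u)) \<le> v \<bullet> (M *v v)"
      by (rule vmax)
    moreover have "(u /\<^sub>R norm u) \<bullet> (M *v (u /\<^sub>R norm u)) = (u \<bullet> (M *v u)) / (norm u)\<^sup>2"
      by (simp add: matrix_vector_mult_scaleR power2_eq_square field_simps)
    ultimately show ?thesis
      using False by (simp add: divide_le_eq power2_norm_eq_inner)
  qed simp
  moreover have "v \<in> W" "v \<bullet> v = 1"
    using \<open>v \<in> S\<close> unfolding S_def by (auto simp: norm_eq_1)
  ultimately show thesis
    using that by blast
qed

lemma rayleigh_maximizer_eigenvector:
  fixes M :: "real^'n^'n"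
  assumes sym: "transpose M = M" and W: "subspace W" and inv: "\<And>x. x \<in> W \<Longrightarrow> M *v x \<in> W"
    and vW: "v \<in> W" and vv: "v \<bullet> v = 1"
    and rayleigh: "\<And>u. u \<in> W \<Longrightarrow> u \<bullet> (M *v u) \<le> (v \<bullet> (M *v v)) * (u \<bullet> u)"
  shows "M *v v = (v \<bullet> (M *v v)) *\<^sub>R v"
proof -
  define m where "m = v \<bullet> (M *v v)"
  have orth: "w \<bullet> (M *v v) = 0" if wW: "w \<in> W" and wv: "w \<bullet> v = 0" for w
  proof -
    have "(- (w \<bullet> (M *v v)))\<^sup>2 \<le> 0 * (m * (w \<bullet> w) - w \<bullet> (M *v w))"
    proof (rule quadratic_nonneg_imp_discriminant_le)
      show "0 \<le> m * (w \<bullet> w) - w \<bullet> (M *v w)"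
        using rayleigh[OF wW] by (simp add: m_def)
      fix t :: real
      have "v \<bullet> (M *v w) = w \<bullet> (M *v v)"
        using symmetric_matrix_inner_commute[OF sym, of w v] by (simp add: inner_commute)
      then have "(v + t *\<^sub>R w) \<bullet> (M *v (v + t *\<^sub>R w))
          = m + 2 * t * (w \<bullet> (M *v v)) + t\<^sup>2 * (w \<bullet> (M *v w))"
        unfolding m_def
        by (simp add: matrix_vector_right_distrib matrix_vector_mult_scaleR inner_add_left
            inner_add_right power2_eq_square algebra_simps)
      moreover have "(v + t *\<^sub>R w) \<bullet> (v + t *\<^sub>R w) = 1 + t\<^sup>2 * (w \<bullet> w)"
        using vv wv by (simp add: inner_add_left inner_add_right inner_commute power2_eq_square)
      moreover have "v + t *\<^sub>R w \<in> W"
        using vW wW W by (simp add: subspace_add subspace_scale)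
      ultimately show "0 \<le> 0 + 2 * t * (- (w \<bullet> (M *v v))) + t\<^sup>2 * (m * (w \<bullet> w) - w \<bullet> (M *v w))"
        using rayleigh[of "v + t *\<^sub>R w"] unfolding m_def[symmetric] by (simp add: algebra_simps)
    qed
    then show ?thesis
      by simp
  qed
  define r where "r = M *v v - m *\<^sub>R v"
  have "r \<in> W"
    unfolding r_def using inv[OF vW] vW W by (simp add: subspace_diff subspace_scale)
  moreover have rv: "r \<bullet> v = 0"
    unfolding r_def m_def using vv by (simp add: inner_diff_left inner_diff_right inner_commute)
  ultimately have "r \<bullet> (M *v v) = 0"
    by (rule orth)
  then have "r \<bullet> r = 0"
    using rv unfolding r_def by (simp add: inner_diff_left inner_diff_right)
  then show ?thesis
    unfolding m_def[symmetric] r_def by simp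
qed

lemma span_insert_orthogonal_complement:
  assumes W: "subspace W" and v: "v \<in> W" "v \<bullet> v = 1" and E: "span E = {x\<in>W. x \<bullet> v = 0}"
  shows "span (insert v E) = W"
proof
  show "span (insert v E) \<subseteq> W"
    using E v W span_superset[of E] by (intro span_minimal) auto
  show "W \<subseteq> span (insert v E)"
  proof
    fix x assume "x \<in> W"
    then have "x - (x \<bullet> v) *\<^sub>R v \<in> span E"
      unfolding E using v W by (simp add: subspace_diff subspace_scale inner_diff_left)
    then have "x - (x \<bullet> v) *\<^sub>R v \<in> span (insert v E)"
      using span_mono[of E "insert v E"] by blast
    moreover have "(x \<bullet> v) *\<^sub>R v \<in> span (insert v E)"
      by (simp add: span_base span_scale)
    ultimately have "(x - (x \<bullet> v) *\<^sub>R v) + (x \<bullet> v) *\<^sub>R v \<in> span (insert v E)"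
      by (rule span_add)
    then show "x \<in> span (insert v E)"
      by simp
  qed
qed

lemma symmetric_matrix_eigenbasis_of_invariant_subspace:
  fixes M :: "real^'n^'n"
  assumes sym: "transpose M = M"
  shows "subspace W \<Longrightarrow> (\<And>x. x \<in> W \<Longrightarrow> M *v x \<in> W) \<Longrightarrow>
    \<exists>E. finite E \<and> orthonormal_on E id \<and> span E = W \<and> (\<forall>e\<in>E. M *v e = (e \<bullet> (M *v e)) *\<^sub>R e)"
proof (induction "dim W" arbitrary: W rule: less_induct)
  case less
  show ?case
  proof (cases "W = {0}")
    case True
    then show ?thesis
      by (intro exI[of _ "{}"]) (auto simp: orthonormal_on_def)
  next
    case False
    obtain v where vW: "v \<in> W" and vv: "v \<bullet> v = 1"
      and "\<And>u. u \<in> W \<Longrightarrow> u \<bullet> (M *v u) \<le> (v \<bullet> (M *v v)) * (u \<bullet> u)"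
      using rayleigh_maximizer_exists[OF less.prems(1) False] by blast
    then have vev: "M *v v = (v \<bullet> (M *v v)) *\<^sub>R v"
      using rayleigh_maximizer_eigenvector[OF sym less.prems vW vv] by blast
    define W' where "W' = {x\<in>W. x \<bullet> v = 0}"
    have W': "subspace W'"
      using less.prems(1) unfolding W'_def subspace_def by (auto simp: inner_add_left)
    have invW': "M *v x \<in> W'" if "x \<in> W'" for x
    proof -
      have "(M *v x) \<bullet> v = (v \<bullet> (M *v v)) * (x \<bullet> v)"
        by (subst symmetric_matrix_inner_commute[OF sym], subst vev) simp
      then show ?thesis
        using that less.prems(2) unfolding W'_def by auto
    qed
    have "W' \<subset> W"
      using vW vv unfolding W'_def by (metis (mono_tags, lifting) mem_Collect_eq psubsetI subsetI zero_neq_one)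
    then have "dim W' < dim W"
      using dim_psubset[of W' W] W' less.prems(1) by (metis span_eq_iff)
    then obtain E' where E': "finite E'" "orthonormal_on E' id" "span E' = W'"
        "\<forall>e\<in>E'. M *v e = (e \<bullet> (M *v e)) *\<^sub>R e"
      using less.hyps[OF _ W' invW'] by blast
    have E'W': "E' \<subseteq> W'"
      using E'(3) span_superset by blast
    then have "orthonormal_on (insert v E') id"
      using E'(2) vv unfolding orthonormal_on_def W'_def by (auto simp: inner_commute)
    moreover have "span (insert v E') = W"
      using span_insert_orthogonal_complement[OF less.prems(1) vW vv] E'(3) unfolding W'_def .
    moreover have "\<forall>e\<in>insert v E'. M *v e = (e \<bullet> (M *v e)) *\<^sub>R e"
      using E'(4) vev by blast
    ultimately show ?thesis
      using E'(1) by blast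
  qed
qed

lemma symmetric_matrix_spectral:
  fixes M :: "real^'n^'n"
  assumes "transpose M = M"
  obtains E \<mu> where "finite E" "orthonormal_on E id" "span E = UNIV"
    "\<And>e. e \<in> E \<Longrightarrow> M *v e = \<mu> e *\<^sub>R e"
proof -
  obtain E where "finite E" "orthonormal_on E id" "span E = UNIV"
    "\<forall>e\<in>E. M *v e = (e \<bullet> (M *v e)) *\<^sub>R e"
    using symmetric_matrix_eigenbasis_of_invariant_subspace[OF assms subspace_UNIV UNIV_I] by blast
  then show thesis
    using that[of E "\<lambda>e. e \<bullet> (M *v e)"] by blast
qed

lemma eigvals_eq_eigenbasis_image:
  fixes A :: "real^'n^'n"
  assumes sym: "transpose A = A" and E: "finite E" "orthonormal_on E id" "span E = UNIV"
    and eig: "\<And>e. e \<in> E \<Longrightarrow> A *v e = \<mu> e *\<^sub>R e"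
  shows "eigvals A = \<mu> ` E"
proof
  have "e \<noteq> 0" if "e \<in> E" for e
    using E(2) that unfolding orthonormal_on_def by fastforce
  then show "\<mu> ` E \<subseteq> eigvals A"
    unfolding eigvals_def using eig by blast
  show "eigvals A \<subseteq> \<mu> ` E"
  proof
    fix \<alpha> assume "\<alpha> \<in> eigvals A"
    then obtain v where v: "v \<noteq> 0" "A *v v = \<alpha> *\<^sub>R v"
      unfolding eigvals_def by auto
    have "orthonormal_proj E id v = v"
      using orthonormal_proj_eq_self[OF E(1,2)] E(3) by simp
    then obtain e where e: "e \<in> E" "e \<bullet> v \<noteq> 0"
      using v(1) unfolding orthonormal_proj_def by (metis (no_types, lifting) id_apply scale_eq_0_iff sum.neutral)
    have "\<alpha> * (e \<bullet> v) = (A *v e) \<bullet> v"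
      using v(2) symmetric_matrix_inner_commute[OF sym, of e v] by simp
    also have "\<dots> = \<mu> e * (e \<bullet> v)"
      using eig[OF e(1)] by simp
    finally show "\<alpha> \<in> \<mu> ` E"
      using e by auto
  qed
qed

section \<open>Positive semidefinite matrices\<close>

lemma psd_cauchy_schwarz:
  fixes B :: "real^'n^'n"
  assumes sym: "transpose B = B" and psd: "\<And>v. 0 \<le> v \<bullet> (B *v v)"
  shows "(u \<bullet> (B *v v))\<^sup>2 \<le> (u \<bullet> (B *v u)) * (v \<bullet> (B *v v))"
proof (rule quadratic_nonneg_imp_discriminant_le[OF psd])
  fix t :: real
  have "v \<bullet> (B *v u) = u \<bullet> (B *v v)"
    using symmetric_matrix_inner_commute[OF sym, of v u] by (simp add: inner_commute)
  then have "(u + t *\<^sub>R v) \<bullet> (B *v (u + t *\<^sub>R v))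
      = u \<bullet> (B *v u) + 2 * t * (u \<bullet> (B *v v)) + t\<^sup>2 * (v \<bullet> (B *v v))"
    by (simp add: matrix_vector_right_distrib matrix_vector_mult_scaleR inner_add_left
        inner_add_right power2_eq_square algebra_simps)
  then show "0 \<le> u \<bullet> (B *v u) + 2 * t * (u \<bullet> (B *v v)) + t\<^sup>2 * (v \<bullet> (B *v v))"
    using psd[of "u + t *\<^sub>R v"] by simp
qed

lemma quadratic_form_le_onorm:
  fixes B :: "real^'n^'n"
  shows "w \<bullet> (B *v w) \<le> onorm ((*v) B) * (norm w)\<^sup>2"
proof -
  have "w \<bullet> (B *v w) \<le> norm w * norm (B *v w)"
    by (rule norm_cauchy_schwarz)
  also have "\<dots> \<le> norm w * (onorm ((*v) B) * norm w)"
    using onorm[OF matrix_vector_mul_bounded_linear, of B w] by (simp add: mult_left_mono)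
  finally show ?thesis
    by (simp add: power2_eq_square algebra_simps)
qed

lemma psd_norm_matrix_vector_sq_le:
  fixes B :: "real^'n^'n"
  assumes sym: "transpose B = B" and psd: "\<And>v. 0 \<le> v \<bullet> (B *v v)"
  shows "(norm (B *v w))\<^sup>2 \<le> onorm ((*v) B) * (w \<bullet> (B *v w))"
proof -
  let ?N = "onorm ((*v) B)"
  have "w \<bullet> (B *v (B *v w)) = (norm (B *v w))\<^sup>2"
    using symmetric_matrix_inner_commute[OF sym, of w "B *v w"] by (simp add: power2_norm_eq_inner)
  then have "((norm (B *v w))\<^sup>2)\<^sup>2 \<le> (w \<bullet> (B *v w)) * ((B *v w) \<bullet> (B *v (B *v w)))"
    using psd_cauchy_schwarz[OF sym psd, of w "B *v w"] by simp
  also have "\<dots> \<le> (w \<bullet> (B *v w)) * (?N * (norm (B *v w))\<^sup>2)"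
    using quadratic_form_le_onorm[of "B *v w" B] psd[of w] by (rule mult_left_mono)
  finally have le: "(norm (B *v w))\<^sup>2 * (norm (B *v w))\<^sup>2 \<le> (?N * (w \<bullet> (B *v w))) * (norm (B *v w))\<^sup>2"
    by (simp add: power2_eq_square algebra_simps)
  show ?thesis
  proof (cases "B *v w = 0")
    case True
    then show ?thesis
      using onorm_pos_le[OF matrix_vector_mul_bounded_linear[of B]] psd[of w] by simp
  next
    case False
    then have "0 < (norm (B *v w))\<^sup>2"
      by simp
    with le show ?thesis
      by (rule mult_right_le_imp_le)
  qed
qed

section \<open>Chebyshev polynomials\<close>

fun chebyshev :: "nat \<Rightarrow> real \<Rightarrow> real" where
  "chebyshev 0 x = 1"
| "chebyshev (Suc 0) x = x"
| "chebyshev (Suc (Suc n)) x = 2 * x * chebyshev (Suc n) x - chebyshev n x"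

lemma chebyshev_cos: "chebyshev n (cos t) = cos (real n * t)"
proof (induction n rule: induct_nat_012)
  case (ge2 n)
  define s where "s = real (Suc n) * t"
  have "chebyshev (Suc (Suc n)) (cos t) = 2 * cos t * cos s - cos (s - t)"
    using ge2 by (simp add: s_def algebra_simps)
  also have "\<dots> = cos (s + t)"
    by (simp add: cos_add cos_diff)
  finally show ?case
    by (simp add: s_def algebra_simps)
qed simp_all

lemma abs_chebyshev_le_1: "\<bar>x\<bar> \<le> 1 \<Longrightarrow> \<bar>chebyshev n x\<bar> \<le> 1"
  by (metis abs_cos_le_one chebyshev_cos cos_arccos_abs)

lemma chebyshev_mean_of_inverses:
  assumes "u * v = 1"
  shows "chebyshev n ((u + v) / 2) = (u ^ n + v ^ n) / 2"
proof (induction n rule: induct_nat_012)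
  case (ge2 n)
  have uv: "u * v ^ Suc n = v ^ n" and vu: "v * u ^ Suc n = u ^ n"
    using assms by (simp_all add: mult.assoc[symmetric] mult.commute)
  have "chebyshev (Suc (Suc n)) ((u + v) / 2)
      = 2 * ((u + v) / 2) * ((u ^ Suc n + v ^ Suc n) / 2) - (u ^ n + v ^ n) / 2"
    by (simp only: chebyshev.simps ge2)
  also have "\<dots> = (u * u ^ Suc n + v * v ^ Suc n + u * v ^ Suc n + v * u ^ Suc n - (u ^ n + v ^ n)) / 2"
    by (simp add: field_simps)
  also have "\<dots> = (u ^ Suc (Suc n) + v ^ Suc (Suc n)) / 2"
    unfolding uv vu by simp
  finally show ?case .
qed simp_all

lemma chebyshev_condition_bound:
  assumes "0 < a" "a < b"
  defines "\<rho> \<equiv> (sqrt (b / a) - 1) / (sqrt (b / a) + 1)"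
  shows "chebyshev n ((b + a) / (b - a)) > 0"
    and "1 / chebyshev n ((b + a) / (b - a)) \<le> 2 * \<rho> ^ n"
proof -
  define r where "r = sqrt (b / a)"
  have r1: "r > 1" and r2: "r\<^sup>2 = b / a"
    unfolding r_def using assms by simp_all
  define u where "u = (r + 1) / (r - 1)"
  have uv: "u * \<rho> = 1" and u0: "u > 0" and \<rho>0: "\<rho> \<ge> 0"
    unfolding u_def \<rho>_def r_def[symmetric] using r1 by simp_all
  have "r * r > 1"
    using less_1_mult[OF r1 r1] .
  then have "(u + \<rho>) / 2 = (r\<^sup>2 + 1) / (r\<^sup>2 - 1)"
    unfolding u_def \<rho>_def r_def[symmetric] using r1
    by (simp add: field_simps power2_eq_square)
  also have "\<dots> = (b + a) / (b - a)"
    unfolding r2 using assms by (simp add: field_simps)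
  finally have T: "chebyshev n ((b + a) / (b - a)) = (u ^ n + \<rho> ^ n) / 2"
    using chebyshev_mean_of_inverses[OF uv, of n] by (simp only:)
  then show pos: "chebyshev n ((b + a) / (b - a)) > 0"
    using u0 \<rho>0 by (simp add: add_pos_nonneg del: divide_const_simps)
  have "1 / chebyshev n ((b + a) / (b - a)) \<le> 1 / (u ^ n / 2)"
    using T u0 \<rho>0 pos by (intro divide_left_mono) simp_all
  also have "\<dots> = 2 * \<rho> ^ n"
    using uv u0 by (simp add: field_simps flip: power_mult_distrib)
  finally show "1 / chebyshev n ((b + a) / (b - a)) \<le> 2 * \<rho> ^ n" .
qed

fun chebyshev_iter :: "('a::real_vector \<Rightarrow> 'a) \<Rightarrow> nat \<Rightarrow> 'a \<Rightarrow> 'a" where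
  "chebyshev_iter L 0 x = x"
| "chebyshev_iter L (Suc 0) x = L x"
| "chebyshev_iter L (Suc (Suc n)) x = 2 *\<^sub>R L (chebyshev_iter L (Suc n) x) - chebyshev_iter L n x"

lemma chebyshev_iter_eigen_sum:
  assumes L: "linear L" and eig: "\<And>i. i \<in> I \<Longrightarrow> L (u i) = \<nu> i *\<^sub>R u i"
  shows "chebyshev_iter L n (\<Sum>i\<in>I. a i *\<^sub>R u i) = (\<Sum>i\<in>I. (a i * chebyshev n (\<nu> i)) *\<^sub>R u i)"
proof -
  have L_sum: "L (\<Sum>i\<in>I. b i *\<^sub>R u i) = (\<Sum>i\<in>I. (b i * \<nu> i) *\<^sub>R u i)" for b
    using eig by (simp add: linear_sum[OF L] linear_scale[OF L])
  show ?thesis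
  proof (induction n rule: induct_nat_012)
    case (ge2 n)
    have "chebyshev_iter L (Suc (Suc n)) (\<Sum>i\<in>I. a i *\<^sub>R u i)
        = (\<Sum>i\<in>I. (2 * (a i * chebyshev (Suc n) (\<nu> i) * \<nu> i)) *\<^sub>R u i)
          - (\<Sum>i\<in>I. (a i * chebyshev n (\<nu> i)) *\<^sub>R u i)"
      using ge2 by (simp add: L_sum scaleR_sum_right)
    also have "\<dots> = (\<Sum>i\<in>I. (a i * chebyshev (Suc (Suc n)) (\<nu> i)) *\<^sub>R u i)"
      unfolding sum_subtractf[symmetric] scaleR_diff_left[symmetric]
      by (intro sum.cong refl arg_cong2[where f = scaleR]) (simp add: algebra_simps)
    finally show ?case .
  qed (simp_all add: L_sum)
qed

lemma norm_chebyshev_iter_le: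
  fixes L :: "'a::real_inner \<Rightarrow> 'a"
  assumes L: "linear L" and E: "finite E" "orthonormal_on E id" "span E = UNIV"
    and eig: "\<And>e. e \<in> E \<Longrightarrow> L e = \<nu> e *\<^sub>R e" and bound: "\<And>e. e \<in> E \<Longrightarrow> \<bar>\<nu> e\<bar> \<le> 1"
  shows "norm (chebyshev_iter L n x) \<le> norm x"
proof -
  have x: "x = (\<Sum>e\<in>E. (e \<bullet> x) *\<^sub>R e)"
    using orthonormal_proj_eq_self[OF E(1,2), of x] E(3) by (simp add: orthonormal_proj_def)
  have "chebyshev_iter L n x = (\<Sum>e\<in>E. ((e \<bullet> x) * chebyshev n (\<nu> e)) *\<^sub>R e)"
    by (subst (1) x) (rule chebyshev_iter_eigen_sum[OF L, of E "\<lambda>e. e"], simp add: eig)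
  then have "(norm (chebyshev_iter L n x))\<^sup>2 = (\<Sum>e\<in>E. ((e \<bullet> x) * chebyshev n (\<nu> e))\<^sup>2)"
    using norm_orthonormal_sum_sq[OF E(1,2)] by simp
  also have "\<dots> \<le> (\<Sum>e\<in>E. (e \<bullet> x)\<^sup>2)"
  proof (rule sum_mono)
    fix e assume "e \<in> E"
    then have "(chebyshev n (\<nu> e))\<^sup>2 \<le> 1"
      using abs_chebyshev_le_1[OF bound] by (simp add: abs_square_le_1)
    then show "((e \<bullet> x) * chebyshev n (\<nu> e))\<^sup>2 \<le> (e \<bullet> x)\<^sup>2"
      by (simp add: power_mult_distrib mult_left_le)
  qed
  also have "\<dots> = (norm x)\<^sup>2"
    using norm_orthonormal_sum_sq[OF E(1,2), of "\<lambda>e. e \<bullet> x"] x[symmetric] by simp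
  finally show ?thesis
    by (rule power2_le_imp_le) simp
qed

section \<open>Krylov subspaces and the Chebyshev bound for eps_k\<close>

lemma krylov_mono: "m \<le> n \<Longrightarrow> krylov A g m \<subseteq> krylov A g n"
  unfolding krylov_def by (rule span_mono) auto

lemma start_mem_krylov: "1 \<le> n \<Longrightarrow> g \<in> krylov A g n"
  unfolding krylov_def by (rule span_base) (auto intro!: exI[of _ 0])

lemma matrix_vector_mult_mem_krylov_Suc:
  assumes "v \<in> krylov A g n"
  shows "A *v v \<in> krylov A g (Suc n)"
proof -
  let ?f = "\<lambda>v. A *v v"
  have "?f ` {(?f ^^ j) g | j. j < n} \<subseteq> {(?f ^^ j) g | j. j < Suc n}"
  proof
    fix y assume "y \<in> ?f ` {(?f ^^ j) g | j. j < n}"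
    then obtain j where "j < n" "y = (?f ^^ Suc j) g"
      by auto
    then show "y \<in> {(?f ^^ j) g | j. j < Suc n}"
      by blast
  qed
  then have "?f ` krylov A g n \<subseteq> krylov A g (Suc n)"
    unfolding krylov_def span_linear_image[OF matrix_vector_mul_linear, symmetric] by (rule span_mono)
  then show ?thesis
    using assms by blast
qed

lemma affine_step_mem_krylov_Suc:
  assumes "v \<in> krylov A g n"
  shows "c *\<^sub>R v - d *\<^sub>R ((A + lam *\<^sub>R mat 1) *v v) \<in> krylov A g (Suc n)"
proof -
  have "v \<in> krylov A g (Suc n)"
    using assms krylov_mono[of n "Suc n"] by auto
  then show ?thesis
    using matrix_vector_mult_mem_krylov_Suc[OF assms] unfolding krylov_def
    by (simp add: span_add span_diff span_scale)
qed

lemma chebyshev_iter_mem_krylov: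
  fixes c d :: real
  assumes sol: "(A + lam *\<^sub>R mat 1) *v x = - g"
  defines "L \<equiv> \<lambda>v. c *\<^sub>R v - d *\<^sub>R ((A + lam *\<^sub>R mat 1) *v v)"
  shows "chebyshev_iter L n x - chebyshev n c *\<^sub>R x \<in> krylov A g n"
proof (induction n rule: induct_nat_012)
  case 0
  then show ?case
    unfolding krylov_def by (simp add: span_zero)
next
  case 1
  then show ?case
    using start_mem_krylov[of 1 g A] sol unfolding L_def krylov_def by (simp add: span_scale)
next
  case (ge2 n)
  define s1 where "s1 = chebyshev_iter L (Suc n) x - chebyshev (Suc n) c *\<^sub>R x"
  define s0 where "s0 = chebyshev_iter L n x - chebyshev n c *\<^sub>R x"
  have "chebyshev_iter L (Suc (Suc n)) x - chebyshev (Suc (Suc n)) c *\<^sub>R x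
      = 2 *\<^sub>R L s1 + (2 * d * chebyshev (Suc n) c) *\<^sub>R g - s0"
    unfolding s1_def s0_def L_def using sol
    by (simp add: algebra_simps matrix_vector_mult_diff_distrib matrix_vector_mult_scaleR)
  moreover have "L s1 \<in> krylov A g (Suc (Suc n))"
    using affine_step_mem_krylov_Suc[of s1 A g "Suc n" c d lam] ge2(2) unfolding L_def s1_def by simp
  moreover have "s0 \<in> krylov A g (Suc (Suc n))"
    using ge2(1) krylov_mono[of n "Suc (Suc n)"] unfolding s0_def by auto
  moreover have "g \<in> krylov A g (Suc (Suc n))"
    by (simp add: start_mem_krylov)
  ultimately show ?case
    unfolding krylov_def by (simp add: span_add span_diff span_scale)
qed

lemma scalar_solution_mem_krylov:
  assumes "a *\<^sub>R x = - g" "a \<noteq> 0" "1 \<le> k"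
  shows "x \<in> krylov A g k"
proof -
  have "x = (1 / a) *\<^sub>R (- g)"
    using assms(1,2) by (subst (asm) eq_commute) simp
  then show ?thesis
    using start_mem_krylov[OF assms(3), of g A] unfolding krylov_def by (simp add: span_scale span_neg)
qed

lemma norm_chebyshev_iter_spectral_map_le:
  fixes A :: "real^'n^'n"
  assumes E: "finite E" "orthonormal_on E id" "span E = UNIV"
    and eig: "\<And>e. e \<in> E \<Longrightarrow> A *v e = \<mu> e *\<^sub>R e"
    and spec: "\<And>e. e \<in> E \<Longrightarrow> a \<le> \<mu> e + lam \<and> \<mu> e + lam \<le> b" and "a < b"
  defines "L \<equiv> \<lambda>v. ((b + a) / (b - a)) *\<^sub>R v - (2 / (b - a)) *\<^sub>R ((A + lam *\<^sub>R mat 1) *v v)"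
  shows "norm (chebyshev_iter L n x) \<le> norm x"
proof (rule norm_chebyshev_iter_le[OF _ E])
  show "linear L"
    unfolding L_def by (rule linearI) (simp_all add: matrix_vector_right_distrib algebra_simps)
  fix e assume "e \<in> E"
  define \<nu> where "\<nu> = \<mu> e + lam"
  have "(A + lam *\<^sub>R mat 1) *v e = \<nu> *\<^sub>R e"
    unfolding \<nu>_def using \<open>e \<in> E\<close> by (intro shifted_eigenvector eig)
  then show "L e = ((b + a - 2 * \<nu>) / (b - a)) *\<^sub>R e"
    unfolding L_def by (simp only:) (simp add: diff_divide_distrib algebra_simps)
  show "\<bar>(b + a - 2 * \<nu>) / (b - a)\<bar> \<le> 1"
    using spec[OF \<open>e \<in> E\<close>] \<open>a < b\<close> unfolding \<nu>_def by (simp add: abs_le_iff divide_le_eq le_divide_eq)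
qed

lemma krylov_chebyshev_approx:
  fixes A :: "real^'n^'n"
  assumes E: "finite E" "orthonormal_on E id" "span E = UNIV"
    and eig: "\<And>e. e \<in> E \<Longrightarrow> A *v e = \<mu> e *\<^sub>R e"
    and spec: "\<And>e. e \<in> E \<Longrightarrow> a \<le> \<mu> e + lam \<and> \<mu> e + lam \<le> b"
    and ab: "0 < a" "a \<le> b" and k: "1 \<le> k"
    and sol: "(A + lam *\<^sub>R mat 1) *v x = - g"
  obtains v where "v \<in> krylov A g k"
    "norm (x - v) \<le> 2 * norm x * ((sqrt (b / a) - 1) / (sqrt (b / a) + 1)) ^ k"
proof (cases "a = b")
  case True
  have "(A + lam *\<^sub>R mat 1) *v x = a *\<^sub>R x"
  proof (rule linear_eq_on_span[OF matrix_vector_mul_linear linear_scaleR])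
    fix e assume "e \<in> E"
    then show "(A + lam *\<^sub>R mat 1) *v e = a *\<^sub>R e"
      using spec True shifted_eigenvector[OF eig] by (metis order_antisym)
  qed (simp add: E(3))
  then have "a *\<^sub>R x = - g"
    using sol by simp
  then have "x \<in> krylov A g k"
    by (rule scalar_solution_mem_krylov) (use ab(1) k in auto)
  then show thesis
    using that[of x] True ab by simp
next
  case False
  then have "a < b"
    using ab by simp
  define c where "c = (b + a) / (b - a)"
  define d where "d = 2 / (b - a)"
  define L where "L = (\<lambda>v. c *\<^sub>R v - d *\<^sub>R ((A + lam *\<^sub>R mat 1) *v v))"
  define T where "T = chebyshev k c"
  define w where "w = chebyshev_iter L k x"
  have "norm w \<le> norm x"
    unfolding w_def L_def c_def d_def by (rule norm_chebyshev_iter_spectral_map_le[OF E eig spec \<open>a < b\<close>])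
  have T: "T > 0" "1 / T \<le> 2 * ((sqrt (b / a) - 1) / (sqrt (b / a) + 1)) ^ k"
    unfolding T_def c_def by (fact chebyshev_condition_bound[OF ab(1) \<open>a < b\<close>])+
  show thesis
  proof (rule that)
    have "w - T *\<^sub>R x \<in> krylov A g k"
      unfolding w_def T_def L_def by (rule chebyshev_iter_mem_krylov[OF sol])
    moreover have "x - (1 / T) *\<^sub>R w = - (1 / T) *\<^sub>R (w - T *\<^sub>R x)"
      using T(1) by (simp add: algebra_simps)
    ultimately show "x - (1 / T) *\<^sub>R w \<in> krylov A g k"
      unfolding krylov_def by (simp add: span_scale span_neg)
    have "norm (x - (x - (1 / T) *\<^sub>R w)) \<le> norm x * (1 / T)"
      using \<open>norm w \<le> norm x\<close> T(1) by (simp add: divide_right_mono)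
    also have "\<dots> \<le> norm x * (2 * ((sqrt (b / a) - 1) / (sqrt (b / a) + 1)) ^ k)"
      using T(2) by (rule mult_left_mono) simp
    finally show "norm (x - (x - (1 / T) *\<^sub>R w)) \<le> 2 * norm x * ((sqrt (b / a) - 1) / (sqrt (b / a) + 1)) ^ k"
      by (simp only: mult.assoc mult.left_commute)
  qed
qed

lemma lanczos_vectorsD:
  assumes "lanczos_vectors A g k q" "1 \<le> k"
  shows "orthonormal_on {1..k} q" "q 1 = (1 / norm g) *\<^sub>R g" "span (q ` {1..k}) = krylov A g k"
  using assms unfolding lanczos_vectors_def orthonormal_on_def by auto

lemma eps_k_eq_norm_diff_proj: "eps_k q k x = norm (x - orthonormal_proj {1..k} q x)"
  by (simp add: eps_k_def orthonormal_proj_def)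

lemma eps_k_chebyshev_bound:
  fixes A :: "real^'n^'n"
  assumes sym: "transpose A = A" and easy: "lam > - alpha_min A" and k: "1 \<le> k"
    and lanczos: "lanczos_vectors A g k q" and sol: "(A + lam *\<^sub>R mat 1) *v x = - g"
  defines "\<kappa> \<equiv> (alpha_max A + lam) / (alpha_min A + lam)"
  shows "eps_k q k x \<le> 2 * norm x * ((sqrt \<kappa> - 1) / (sqrt \<kappa> + 1)) ^ k"
proof -
  obtain E \<mu> where E: "finite E" "orthonormal_on E id" "span E = UNIV"
    and eig: "\<And>e. e \<in> E \<Longrightarrow> A *v e = \<mu> e *\<^sub>R e"
    using symmetric_matrix_spectral[OF sym] by blast
  have eigvals: "eigvals A = \<mu> ` E"
    by (rule eigvals_eq_eigenbasis_image[OF sym E eig])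
  have "E \<noteq> {}"
  proof
    assume "E = {}"
    then have "(UNIV :: (real^'n) set) = {0}"
      using E(3) by simp
    then show False
      using UNIV_not_singleton by blast
  qed
  have bounds: "alpha_min A \<le> \<mu> e \<and> \<mu> e \<le> alpha_max A" if "e \<in> E" for e
    unfolding alpha_min_def alpha_max_def eigvals using E(1) that by simp
  then have spec: "\<And>e. e \<in> E \<Longrightarrow> alpha_min A + lam \<le> \<mu> e + lam \<and> \<mu> e + lam \<le> alpha_max A + lam"
    by simp
  have ab: "alpha_min A + lam \<le> alpha_max A + lam"
    using bounds \<open>E \<noteq> {}\<close> by (meson all_not_in_conv add_right_mono order_trans)
  have a: "0 < alpha_min A + lam"
    using easy by simp
  obtain v where "v \<in> krylov A g k"
    and v: "norm (x - v) \<le> 2 * norm x * ((sqrt \<kappa> - 1) / (sqrt \<kappa> + 1)) ^ k"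
    using krylov_chebyshev_approx[OF E eig spec a ab k sol] unfolding \<kappa>_def by blast
  then have "eps_k q k x \<le> norm (x - v)"
    using lanczos_vectorsD[OF lanczos k] unfolding eps_k_eq_norm_diff_proj
    by (intro norm_diff_orthonormal_proj_le) simp_all
  with v show ?thesis
    by linarith
qed

section \<open>The GLTR iterate and its residual\<close>

lemma inner_lanczos_g:
  fixes k :: nat
  assumes "orthonormal_on {1..k} q" "q 1 = (1 / norm g) *\<^sub>R g" "g \<noteq> 0" "1 \<le> k" "i \<in> {1..k}"
  shows "q i \<bullet> g = norm g * (if i = 1 then 1 else 0)"
proof -
  have "g = norm g *\<^sub>R q 1"
    using assms(2,3) by simp
  then have "q i \<bullet> g = norm g * (q i \<bullet> q 1)"
    by (metis inner_scaleR_right)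
  moreover have "1 \<in> {1..k}"
    using assms(4) by simp
  then have "q i \<bullet> q 1 = (if i = 1 then 1 else 0)"
    using assms(1,5) unfolding orthonormal_on_def by blast
  ultimately show ?thesis
    by simp
qed

lemma inner_lanczos_matrix_lanczos_comb:
  "q i \<bullet> (A *v lanczos_comb q k c) = (\<Sum>j=1..k. lanczos_T A q i j * c j)"
  unfolding lanczos_comb_def lanczos_T_def
  by (simp add: vec.sum matrix_vector_mult_scaleR inner_sum_right mult.commute)

lemma lanczos_comb_inner: "lanczos_comb q k c \<bullet> y = (\<Sum>i=1..k. c i * (q i \<bullet> y))"
  by (simp add: lanczos_comb_def inner_sum_left)

lemma knorm_eq_norm_lanczos_comb:
  assumes "orthonormal_on {1..k} q"
  shows "knorm k c = norm (lanczos_comb q k c)"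
proof -
  have "(norm (lanczos_comb q k c))\<^sup>2 = (\<Sum>i=1..k. (c i)\<^sup>2)"
    unfolding lanczos_comb_def by (rule norm_orthonormal_sum_sq[OF _ assms]) simp
  then show ?thesis
    unfolding knorm_def by (metis real_sqrt_abs abs_norm_cancel)
qed

lemma gltr_phi_eq_trs_f:
  assumes orth: "orthonormal_on {1..k} q" and q1: "q 1 = (1 / norm g) *\<^sub>R g"
    and "g \<noteq> 0" "1 \<le> k"
  shows "gltr_phi A g q k c = trs_f A g (lanczos_comb q k c)"
proof -
  have "lanczos_comb q k c \<bullet> (A *v lanczos_comb q k c)
      = (\<Sum>i=1..k. c i * (q i \<bullet> (A *v lanczos_comb q k c)))"
    by (simp add: lanczos_comb_def inner_sum_left)
  also have "\<dots> = (\<Sum>i=1..k. \<Sum>j=1..k. c i * lanczos_T A q i j * c j)"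
    by (simp add: inner_lanczos_matrix_lanczos_comb sum_distrib_left mult.assoc)
  finally have quad: "lanczos_comb q k c \<bullet> (A *v lanczos_comb q k c)
      = (\<Sum>i=1..k. \<Sum>j=1..k. c i * lanczos_T A q i j * c j)" .
  have "lanczos_comb q k c \<bullet> g = (\<Sum>i=1..k. c i * (q i \<bullet> g))"
    by (simp add: lanczos_comb_def inner_sum_left)
  also have "\<dots> = (\<Sum>i=1..k. if i = 1 then norm g * c i else 0)"
    using inner_lanczos_g[OF assms] by (intro sum.cong) auto
  also have "\<dots> = norm g * c 1"
    using \<open>1 \<le> k\<close> by simp
  finally show ?thesis
    unfolding gltr_phi_def trs_f_def quad by simp
qed

lemma gltr_sol_residual_orthogonal:
  assumes gltr: "gltr_sol A g \<Delta> q k h lam" and lanczos: "lanczos_vectors A g k q"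
    and "g \<noteq> 0" "1 \<le> k"
  shows "((A + lam *\<^sub>R mat 1) *v lanczos_comb q k h + g) \<bullet> lanczos_comb q k h = 0"
proof -
  let ?r = "(A + lam *\<^sub>R mat 1) *v lanczos_comb q k h + g"
  note L = lanczos_vectorsD[OF lanczos \<open>1 \<le> k\<close>]
  have qr: "q i \<bullet> ?r = 0" if "i \<in> {1..k}" for i
  proof -
    have "q i \<bullet> ?r = q i \<bullet> (A *v lanczos_comb q k h) + lam * (q i \<bullet> lanczos_comb q k h) + q i \<bullet> g"
      by (simp add: inner_add_right)
    also have "\<dots> = (\<Sum>j=1..k. lanczos_T A q i j * h j) + lam * h i + norm g * (if i = 1 then 1 else 0)"
      using inner_orthonormal_sum[OF _ L(1) that, of h] inner_lanczos_g[OF L(1,2) assms(3,4) that]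
      unfolding lanczos_comb_def[symmetric] by (simp add: inner_lanczos_matrix_lanczos_comb)
    finally have "q i \<bullet> ?r = (\<Sum>j=1..k. lanczos_T A q i j * h j) + lam * h i + norm g * (if i = 1 then 1 else 0)" .
    then show ?thesis
      using gltr that unfolding gltr_sol_def by simp
  qed
  have "?r \<bullet> lanczos_comb q k h = (\<Sum>i=1..k. h i * (q i \<bullet> ?r))"
    by (subst inner_commute) (rule lanczos_comb_inner)
  also have "\<dots> = 0"
    using qr by simp
  finally show ?thesis .
qed

lemma gltr_sol_trs_f_le:
  assumes gltr: "gltr_sol A g \<Delta> q k h lam" and lanczos: "lanczos_vectors A g k q"
    and "g \<noteq> 0" "1 \<le> k" and y: "y \<in> krylov A g k" "norm y \<le> \<Delta>"
  shows "trs_f A g (lanczos_comb q k h) \<le> trs_f A g y"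
proof -
  note L = lanczos_vectorsD[OF lanczos \<open>1 \<le> k\<close>]
  define c where "c = (\<lambda>i. q i \<bullet> y)"
  have yc: "y = lanczos_comb q k c"
    using orthonormal_proj_eq_self[OF _ L(1), of y] y(1) L(3)
    by (simp add: orthonormal_proj_def lanczos_comb_def c_def inner_commute)
  have "knorm k c = norm y"
    unfolding yc by (rule knorm_eq_norm_lanczos_comb[OF L(1)])
  then have "gltr_phi A g q k h \<le> gltr_phi A g q k c"
    using gltr y(2) unfolding gltr_sol_def by simp
  then show ?thesis
    unfolding yc gltr_phi_eq_trs_f[OF L(1,2) assms(3,4)] .
qed

lemma trs_f_diff_on_sphere:
  fixes A :: "real^'n^'n"
  assumes sym: "transpose A = A" and sol: "(A + lam *\<^sub>R mat 1) *v xo = - g"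
    and xo: "norm xo = D" and x: "norm x = D"
  shows "trs_f A g x - trs_f A g xo = (x - xo) \<bullet> ((A + lam *\<^sub>R mat 1) *v (x - xo)) / 2"
proof -
  let ?B = "A + lam *\<^sub>R mat 1"
  have "(x - xo) \<bullet> (?B *v (x - xo)) = x \<bullet> (?B *v x) - x \<bullet> (?B *v xo) - xo \<bullet> (?B *v x) + xo \<bullet> (?B *v xo)"
    by (simp only: matrix_vector_mult_diff_distrib inner_diff_left inner_diff_right)
  moreover have "xo \<bullet> (?B *v x) = x \<bullet> (?B *v xo)"
    using symmetric_matrix_inner_commute[OF symmetric_matrix_shift[OF sym, of lam], of xo x]
    by (simp only: inner_commute)
  moreover have "x \<bullet> (?B *v x) = x \<bullet> (A *v x) + lam * D\<^sup>2"
    using x by (simp add: inner_add_right dot_square_norm)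
  moreover have "xo \<bullet> (?B *v xo) = xo \<bullet> (A *v xo) + lam * D\<^sup>2"
    using xo by (simp add: inner_add_right dot_square_norm)
  moreover have "x \<bullet> (?B *v xo) = - (x \<bullet> g)" "xo \<bullet> (?B *v xo) = - (xo \<bullet> g)"
    using sol by simp_all
  ultimately show ?thesis
    unfolding trs_f_def by linarith
qed

lemma residual_norm_le:
  fixes A :: "real^'n^'n" and lam :: real
  defines "B \<equiv> A + lam *\<^sub>R mat 1"
  assumes sym: "transpose A = A" and psd: "\<And>v. 0 \<le> v \<bullet> (B *v v)"
    and sol: "B *v xo = - g" and "norm xo = D" "norm x = D" "norm y = D"
    and le: "trs_f A g x \<le> trs_f A g y"
    and orth: "((A + \<mu> *\<^sub>R mat 1) *v x + g) \<bullet> x = 0"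
  shows "norm ((A + \<mu> *\<^sub>R mat 1) *v x + g) \<le> onorm ((*v) B) * norm (y - xo)"
proof -
  let ?r = "(A + \<mu> *\<^sub>R mat 1) *v x + g"
  let ?N = "onorm ((*v) B)"
  have symB: "transpose B = B"
    unfolding B_def by (rule symmetric_matrix_shift[OF sym])
  have N: "0 \<le> ?N"
    by (rule onorm_pos_le[OF matrix_vector_mul_bounded_linear])
  have "B *v (x - xo) = ?r + (lam - \<mu>) *\<^sub>R x"
    using sol unfolding B_def matrix_vector_mult_diff_distrib
    by (simp only: matrix_vector_mult_shift) (simp add: algebra_simps)
  then have "(norm (B *v (x - xo)))\<^sup>2 = (norm ?r)\<^sup>2 + (norm ((lam - \<mu>) *\<^sub>R x))\<^sup>2"
    using orth by (simp add: norm_add_Pythagorean orthogonal_def)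
  then have "(norm ?r)\<^sup>2 \<le> (norm (B *v (x - xo)))\<^sup>2"
    by simp
  also have "\<dots> \<le> ?N * ((x - xo) \<bullet> (B *v (x - xo)))"
    by (rule psd_norm_matrix_vector_sq_le[OF symB psd])
  also have "\<dots> \<le> ?N * ((y - xo) \<bullet> (B *v (y - xo)))"
  proof (rule mult_left_mono[OF _ N])
    have "trs_f A g x - trs_f A g xo = (x - xo) \<bullet> (B *v (x - xo)) / 2"
      "trs_f A g y - trs_f A g xo = (y - xo) \<bullet> (B *v (y - xo)) / 2"
      by (rule trs_f_diff_on_sphere[OF sym sol[unfolded B_def] assms(5), folded B_def], fact)+
    then show "(x - xo) \<bullet> (B *v (x - xo)) \<le> (y - xo) \<bullet> (B *v (y - xo))"
      using le by linarith
  qed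
  also have "\<dots> \<le> ?N * (?N * (norm (y - xo))\<^sup>2)"
    by (intro mult_left_mono N quadratic_form_le_onorm)
  also have "\<dots> = (?N * norm (y - xo))\<^sup>2"
    by (simp add: power2_eq_square)
  finally show ?thesis
    by (rule power2_le_imp_le) (simp add: N)
qed

lemma sphere_chord_sq_le:
  fixes s D :: real
  assumes "0 \<le> s" "s \<le> D" "0 < D"
  shows "2 * D * (D - s) \<le> (1 + (D\<^sup>2 - s\<^sup>2) / D\<^sup>2) * (D\<^sup>2 - s\<^sup>2)"
proof -
  have "(1 + (D\<^sup>2 - s\<^sup>2) / D\<^sup>2) * (D\<^sup>2 - s\<^sup>2) - 2 * D * (D - s) = s * (D - s)\<^sup>2 * (2 * D + s) / D\<^sup>2"
    using assms(3) by (simp add: field_simps power2_eq_square)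
  also have "\<dots> \<ge> 0"
    using assms by simp
  finally show ?thesis
    by simp
qed

lemma sphere_point_aligned_with_proj:
  assumes I: "finite I" "orthonormal_on I u" "i0 \<in> I" and D: "0 < D"
  obtains y where "y \<in> span (u ` I)" "norm y = D" "y \<bullet> x = D * norm (orthonormal_proj I u x)"
proof -
  define p where "p = orthonormal_proj I u x"
  define y where "y = (if p = 0 then D *\<^sub>R u i0 else (D / norm p) *\<^sub>R p)"
  have pS: "p \<in> span (u ` I)"
    unfolding p_def by (rule orthonormal_proj_in_span)
  have yS: "y \<in> span (u ` I)"
    unfolding y_def using pS I(3) by (simp add: span_scale span_base)
  have "u i0 \<bullet> u i0 = 1"
    using I(2,3) unfolding orthonormal_on_def by simp
  then have "norm y = D"
    unfolding y_def using D by (auto simp: norm_eq_1)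
  moreover have "y \<bullet> x = y \<bullet> p"
    using inner_diff_orthonormal_proj[OF I(1,2) yS, of x] unfolding p_def by (simp add: inner_diff_right)
  moreover have "\<dots> = D * norm p"
    unfolding y_def using D by (auto simp: dot_square_norm power2_eq_square)
  ultimately show thesis
    using that yS unfolding p_def by simp
qed

lemma sphere_point_near_proj:
  assumes I: "finite I" "orthonormal_on I u" "i0 \<in> I" and x: "norm x = D" and D: "0 < D"
  defines "\<epsilon> \<equiv> norm (x - orthonormal_proj I u x)"
  obtains y where "y \<in> span (u ` I)" "norm y = D" "norm (y - x) \<le> sqrt (1 + \<epsilon>\<^sup>2 / D\<^sup>2) * \<epsilon>"
proof -
  define s where "s = norm (orthonormal_proj I u x)"
  obtain y where yS: "y \<in> span (u ` I)" and ny: "norm y = D" and yx: "y \<bullet> x = D * s"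
    unfolding s_def by (rule sphere_point_aligned_with_proj[OF I D])
  have eps: "\<epsilon>\<^sup>2 = D\<^sup>2 - s\<^sup>2"
    unfolding \<epsilon>_def s_def norm_diff_orthonormal_proj_sq[OF I(1,2)] x ..
  then have "s\<^sup>2 \<le> D\<^sup>2"
    using zero_le_power2[of \<epsilon>] by linarith
  then have "s \<le> D"
    using D by (intro power2_le_imp_le[of s]) simp_all
  have "(norm (y - x))\<^sup>2 = (norm y)\<^sup>2 - 2 * (y \<bullet> x) + (norm x)\<^sup>2"
    by (simp add: power2_norm_eq_inner inner_diff_left inner_diff_right inner_commute)
  also have "\<dots> = 2 * D * (D - s)"
    using ny x yx by (simp add: power2_eq_square algebra_simps)
  also have "\<dots> \<le> (1 + \<epsilon>\<^sup>2 / D\<^sup>2) * \<epsilon>\<^sup>2"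
    unfolding eps using sphere_chord_sq_le[OF _ \<open>s \<le> D\<close> D] by (simp add: s_def)
  finally have "norm (y - x) \<le> sqrt ((1 + \<epsilon>\<^sup>2 / D\<^sup>2) * \<epsilon>\<^sup>2)"
    by (rule real_le_rsqrt)
  also have "\<dots> = sqrt (1 + \<epsilon>\<^sup>2 / D\<^sup>2) * \<epsilon>"
    by (simp add: real_sqrt_mult \<epsilon>_def)
  finally show thesis
    using that yS ny by blast
qed

lemma gltr_residual_bound:
  fixes A :: "real^'n^'n" and lam \<mu> :: real
  assumes sym: "transpose A = A" and "g \<noteq> 0" and \<Delta>: "0 < \<Delta>"
    and sol: "(A + lam *\<^sub>R mat 1) *v x = - g" and psd: "\<forall>v. 0 \<le> v \<bullet> ((A + lam *\<^sub>R mat 1) *v v)"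
    and k: "1 \<le> k" and lanczos: "lanczos_vectors A g k q" and gltr: "gltr_sol A g \<Delta> q k h \<mu>"
    and x: "norm x = \<Delta>" and xk: "norm (lanczos_comb q k h) = \<Delta>"
  defines "\<epsilon> \<equiv> eps_k q k x"
  shows "norm ((A + \<mu> *\<^sub>R mat 1) *v lanczos_comb q k h + g)
    \<le> onorm ((*v) (A + lam *\<^sub>R mat 1)) * sqrt (1 + \<epsilon>\<^sup>2 / \<Delta>\<^sup>2) * \<epsilon>"
proof -
  let ?N = "onorm ((*v) (A + lam *\<^sub>R mat 1))"
  note L = lanczos_vectorsD[OF lanczos k]
  obtain y where y: "y \<in> krylov A g k" "norm y = \<Delta>" "norm (y - x) \<le> sqrt (1 + \<epsilon>\<^sup>2 / \<Delta>\<^sup>2) * \<epsilon>"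
    using sphere_point_near_proj[OF _ L(1) _ x \<Delta>, of 1] k L(3)
    unfolding \<epsilon>_def eps_k_eq_norm_diff_proj by auto
  have "norm ((A + \<mu> *\<^sub>R mat 1) *v lanczos_comb q k h + g) \<le> ?N * norm (y - x)"
  proof (rule residual_norm_le[OF sym _ sol x xk y(2)])
    show "trs_f A g (lanczos_comb q k h) \<le> trs_f A g y"
      using y by (intro gltr_sol_trs_f_le[OF gltr lanczos \<open>g \<noteq> 0\<close> k]) simp_all
  qed (use psd gltr_sol_residual_orthogonal[OF gltr lanczos \<open>g \<noteq> 0\<close> k] in simp_all)
  also have "\<dots> \<le> ?N * sqrt (1 + \<epsilon>\<^sup>2 / \<Delta>\<^sup>2) * \<epsilon>"
    using mult_left_mono[OF y(3) onorm_pos_le[OF matrix_vector_mul_bounded_linear]] by (simp add: mult.assoc)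
  finally show ?thesis .
qed

lemma sqrt_one_plus_sq_div_mult_le:
  fixes N D \<epsilon> t :: real
  assumes "0 \<le> N" "0 < D" "\<epsilon> \<le> 2 * D * t"
  shows "N * sqrt (1 + \<epsilon>\<^sup>2 / D\<^sup>2) * \<epsilon> \<le> 2 * N * sqrt (D\<^sup>2 + \<epsilon>\<^sup>2) * t"
proof -
  have "sqrt (1 + \<epsilon>\<^sup>2 / D\<^sup>2) = sqrt (D\<^sup>2 + \<epsilon>\<^sup>2) / D"
    using assms(2) by (simp add: field_simps real_sqrt_divide)
  then have "N * sqrt (1 + \<epsilon>\<^sup>2 / D\<^sup>2) * \<epsilon> = (N * sqrt (D\<^sup>2 + \<epsilon>\<^sup>2)) * (\<epsilon> / D)"
    by simp
  also have "\<dots> \<le> (N * sqrt (D\<^sup>2 + \<epsilon>\<^sup>2)) * (2 * t)"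
    using assms by (intro mult_left_mono) (simp_all add: divide_le_eq mult.commute mult.left_commute)
  finally show ?thesis
    by (simp add: mult_ac)
qed

theorem theorem3p5:
  fixes A :: "real^'n^'n" and g x_opt :: "real^'n" and \<Delta> lam_opt lam_k :: real
    and q :: "nat \<Rightarrow> real^'n" and h :: "nat \<Rightarrow> real" and k :: nat
  assumes sym: "transpose A = A"
    and g_nz: "g \<noteq> 0"
    and Delta_pos: "\<Delta> > 0"
    and opt_feas: "norm x_opt \<le> \<Delta>"
    and opt_min: "\<forall>x. norm x \<le> \<Delta> \<longrightarrow> trs_f A g x_opt \<le> trs_f A g x"
    and lam_nonneg: "lam_opt \<ge> 0"
    and opt_eq: "(A + lam_opt *\<^sub>R mat 1) *v x_opt = - g"
    and opt_compl: "lam_opt * (\<Delta> - norm x_opt) = 0"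
    and opt_psd: "\<forall>v. v \<bullet> ((A + lam_opt *\<^sub>R mat 1) *v v) \<ge> 0"
    and easy: "lam_opt > - alpha_min A"
    and k_range: "1 \<le> k" "k \<le> k_max A g"
    and lanczos: "lanczos_vectors A g k q"
    and gltr: "gltr_sol A g \<Delta> q k h lam_k"
    and bd_opt: "norm x_opt = \<Delta>"
    and bd_k: "norm (lanczos_comb q k h) = \<Delta>"
  shows
    "let A_opt = A + lam_opt *\<^sub>R mat 1;
         nA = onorm (\<lambda>v. A_opt *v v);
         \<kappa> = (alpha_max A + lam_opt) / (alpha_min A + lam_opt);
         x_k = lanczos_comb q k h;
         r_k = (A + lam_k *\<^sub>R mat 1) *v x_k + g;
         \<epsilon> = eps_k q k x_opt
     in norm r_k \<le> nA * sqrt (1 + \<epsilon>^2 / \<Delta>^2) * \<epsilon>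
        \<and> nA * sqrt (1 + \<epsilon>^2 / \<Delta>^2) * \<epsilon>
            \<le> 2 * nA * sqrt (\<Delta>^2 + \<epsilon>^2) * ((sqrt \<kappa> - 1) / (sqrt \<kappa> + 1)) ^ k"
proof -
  have "eps_k q k x_opt \<le> 2 * \<Delta> * ((sqrt ((alpha_max A + lam_opt) / (alpha_min A + lam_opt)) - 1)
      / (sqrt ((alpha_max A + lam_opt) / (alpha_min A + lam_opt)) + 1)) ^ k"
    using eps_k_chebyshev_bound[OF sym easy k_range(1) lanczos opt_eq] bd_opt by simp
  then show ?thesis
    unfolding Let_def
    using gltr_residual_bound[OF sym g_nz Delta_pos opt_eq opt_psd k_range(1) lanczos gltr bd_opt bd_k]
      sqrt_one_plus_sq_div_mult_le[OF onorm_pos_le[OF matrix_vector_mul_bounded_linear] Delta_pos]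
    by simp
qed

end
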